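(* The determinants of the set of real Toeplitz matrices cannot be evaluated accurately using any enumerable set of bounded-degree black-box operations. That is, given any enumerable set of black-box operations of bounded degree, it is not the case that for every $n$ the determinant of the $n$-by-$n$ Toeplitz matrix $T$ with $x_j$ on its $j$-th diagonal ($1-n\le j\le n-1$), as a polynomial in $(x_{1-n},\dots,x_{n-1})\in\mathbb{R}^{2n-1}$, is accurately evaluable on $\mathbb{R}^{2n-1}$ using these operations.
   Context: Toeplitz notation: $x_0$ is on the main diagonal, $x_{n-1}$ is in the top right corner, and $x_{1-n}$ is in the bottom left corner; the $2n-1$ entries are independent real variables. Black boxes. A black-box operation takes finitely many inputs $x_1,\dots,x_k$ (each black box has a finite number of arguments) and produces a polynomial $q(x_1,\dots,x_k)$. A set $\{q_j:j\in J\}$ of black-box operations has bounded degree if the degrees of the $q_j$ are bounded by a common constant. The set is always taken to include $x_1x_2$, $x_1+x_2$ and $x_1-x_2$. Extended arithmetic over $\mathbb{R}$. An algorithm using the set $\{q_j\}$ receives its input $x\in\mathbb{R}^N$ exactly and is a finite directed acyclic graph with input, computational, branching and output nodes. Each computational node applies some $q_j$ to its inputs $a_1,\dots,a_l$ (possibly with repetitions) and returns $q_j(a_1,\dots,a_l)(1+\delta_i)$, with $\delta_i\in\mathbb{R}$ a rounding error attached to that node; the $\delta_i$ of different nodes are independent variables. Negation is also available and is exact. The algorithm may or may not use comparisons and branching. It terminates in finitely many steps; its output is $p_{comp}(x,\delta)$, $\delta=(\delta_1,\dots,\delta_k)$, and $p_{comp}(x,0)=p(x)$, where $p$ is the polynomial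 being evaluated. It is accurate for $p$ on a domain $\mathcal{D}\subseteq\mathbb{R}^N$ if for every $0<\eta<1$ there is $0<\epsilon<1$ such that for all $x\in\mathcal{D}$ and all $\delta$ with all $|\delta_i|\le\epsilon$, $|p_{comp}(x,\delta)-p(x)|\le\eta|p(x)|$. The polynomial $p$ is accurately evaluable on $\mathcal{D}$ if an accurate algorithm for $p$ on $\mathcal{D}$ exists. *)

theory Defs
  imports
    "HOL-Library.Poly_Mapping"
    "HOL-Library.FuncSet"
    "HOL-Library.Countable_Set"
    "Jordan_Normal_Form.Determinant"
begin

type_synonym real_mpoly = "(nat \<Rightarrow>\<^sub>0 nat) \<Rightarrow>\<^sub>0 real"

definition var :: "nat \<Rightarrow> real_mpoly" where
  "var i = Poly_Mapping.single (Poly_Mapping.single i 1) 1"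

definition mpoly_vars :: "real_mpoly \<Rightarrow> nat set" where
  "mpoly_vars q = (\<Union>m \<in> Poly_Mapping.keys q. Poly_Mapping.keys m)"

definition mpoly_eval :: "real_mpoly \<Rightarrow> (nat \<Rightarrow> real) \<Rightarrow> real" where
  "mpoly_eval q a =
     (\<Sum>m \<in> Poly_Mapping.keys q. Poly_Mapping.lookup q m *
        (\<Prod>i \<in> Poly_Mapping.keys m. a i ^ Poly_Mapping.lookup m i))"

definition monomial_degree :: "(nat \<Rightarrow>\<^sub>0 nat) \<Rightarrow> nat" where
  "monomial_degree m = (\<Sum>i \<in> Poly_Mapping.keys m. Poly_Mapping.lookup m i)"

text \<open>Total degree; the inserted 0 gives the zero polynomial degree 0.\<close>

definition total_degree :: "real_mpoly \<Rightarrow> nat" where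
  "total_degree q = Max (insert 0 (monomial_degree ` Poly_Mapping.keys q))"

text \<open>
  A black box is a number of arguments k together with a polynomial in the k variables
  with indices 0, ..., k - 1.
\<close>

type_synonym blackbox = "nat \<times> real_mpoly"

definition is_blackbox :: "blackbox \<Rightarrow> bool" where
  "is_blackbox b \<longleftrightarrow> mpoly_vars (snd b) \<subseteq> {..<fst b}"

definition apply_blackbox :: "blackbox \<Rightarrow> real list \<Rightarrow> real" where
  "apply_blackbox b as = mpoly_eval (snd b) (\<lambda>i. as ! i)"

definition basic_blackboxes :: "blackbox set" where
  "basic_blackboxes = {(2, var 0 * var 1), (2, var 0 + var 1), (2, var 0 - var 1)}"

definition blackbox_set :: "blackbox set \<Rightarrow> bool" where
  "blackbox_set Q \<longleftrightarrow> (\<forall>b \<in> Q. is_blackbox b) \<and> basic_blackboxes \<subseteq> Q"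

definition bounded_degree :: "blackbox set \<Rightarrow> bool" where
  "bounded_degree Q \<longleftrightarrow> (\<exists>d. \<forall>b \<in> Q. total_degree (snd b) \<le> d)"

text \<open>
  An algorithm is a finite directed acyclic graph, given by the list of its nodes in a
  topological order; nodes are referred to by their position in the list, and execution
  starts at position 0. The input nodes are not listed: the input node holding the
  coordinate v of the input is the operand \<open>Inp v\<close>. The operand \<open>Res i\<close>
  is the result of the computational node i. Exact negation is part of the operands, so that
  it carries no rounding error. The numbers at the end of \<open>Compute\<close> and
  \<open>Branch\<close> are the positions of the node to be executed next (for
  \<open>Branch\<close>: if the comparison holds, and if it does not).
\<close>

datatype (operand_inputs: 'v) operand = Inp 'v | Res nat | Neg "'v operand"

datatype comparison = Cmp_Less | Cmp_Le | Cmp_Eq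

datatype (node_inputs: 'v) node =
    Compute blackbox "'v operand list" nat
  | Branch comparison "'v operand" "'v operand" nat nat
  | Output "'v operand"

type_synonym 'v graph = "'v node list"

text \<open>The map \<open>env\<close> holds the results of the computational nodes executed so far.\<close>

primrec operand_value :: "('v \<Rightarrow> real) \<Rightarrow> (nat \<rightharpoonup> real) \<Rightarrow> 'v operand \<Rightarrow> real option" where
  "operand_value x env (Inp v) = Some (x v)"
| "operand_value x env (Res i) = env i"
| "operand_value x env (Neg a) = map_option uminus (operand_value x env a)"

primrec compare :: "comparison \<Rightarrow> real \<Rightarrow> real \<Rightarrow> bool" where
  "compare Cmp_Less s t \<longleftrightarrow> s < t"
| "compare Cmp_Le s t \<longleftrightarrow> s \<le> t"
| "compare Cmp_Eq s t \<longleftrightarrow> s = t"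

text \<open>
  \<open>run G x \<delta> i env y\<close>: execution from node i on, with input x, rounding errors
  \<open>\<delta>\<close> (one for each node) and the results \<open>env\<close>, ends with output y.
  An execution that uses the result of a node that has not been executed has no output.
\<close>

inductive run ::
  "'v graph \<Rightarrow> ('v \<Rightarrow> real) \<Rightarrow> (nat \<Rightarrow> real) \<Rightarrow> nat \<Rightarrow> (nat \<rightharpoonup> real) \<Rightarrow> real \<Rightarrow> bool"
  for G :: "'v graph" and x :: "'v \<Rightarrow> real" and \<delta> :: "nat \<Rightarrow> real"
where
  run_Compute:
    "\<lbrakk>i < length G; G ! i = Compute b args j;
      map (operand_value x env) args = map Some vals;
      run G x \<delta> j (env(i \<mapsto> apply_blackbox b vals * (1 + \<delta> i))) y\<rbrakk>
     \<Longrightarrow> run G x \<delta> i env y"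
| run_Branch:
    "\<lbrakk>i < length G; G ! i = Branch c a b j k;
      operand_value x env a = Some s; operand_value x env b = Some t;
      run G x \<delta> (if compare c s t then j else k) env y\<rbrakk>
     \<Longrightarrow> run G x \<delta> i env y"
| run_Output:
    "\<lbrakk>i < length G; G ! i = Output a; operand_value x env a = Some y\<rbrakk>
     \<Longrightarrow> run G x \<delta> i env y"

definition p_comp :: "'v graph \<Rightarrow> ('v \<Rightarrow> real) \<Rightarrow> (nat \<Rightarrow> real) \<Rightarrow> real" where
  "p_comp G x \<delta> = (THE y. run G x \<delta> 0 Map.empty y)"

text \<open>
  The space of inputs with coordinates indexed by the finite set V is
  \<open>V \<rightarrow>\<^sub>E UNIV\<close>. Edges lead to later positions, so the graph is acyclic.
\<close>

fun node_ok :: "blackbox set \<Rightarrow> 'v graph \<Rightarrow> nat \<Rightarrow> 'v node \<Rightarrow> bool" where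
  "node_ok Q G i (Compute b args j) \<longleftrightarrow>
     b \<in> Q \<and> length args = fst b \<and> j \<in> {i<..<length G}"
| "node_ok Q G i (Branch c a b j k) \<longleftrightarrow> j \<in> {i<..<length G} \<and> k \<in> {i<..<length G}"
| "node_ok Q G i (Output a) \<longleftrightarrow> True"

definition algorithm :: "blackbox set \<Rightarrow> 'v set \<Rightarrow> 'v graph \<Rightarrow> bool" where
  "algorithm Q V G \<longleftrightarrow>
     (\<forall>i < length G. node_ok Q G i (G ! i) \<and> node_inputs (G ! i) \<subseteq> V) \<and>
     (\<forall>x \<in> V \<rightarrow>\<^sub>E UNIV. \<forall>\<delta>. \<exists>!y. run G x \<delta> 0 Map.empty y)"

definition algorithm_for ::
  "blackbox set \<Rightarrow> 'v set \<Rightarrow> (('v \<Rightarrow> real) \<Rightarrow> real) \<Rightarrow> 'v graph \<Rightarrow> bool" where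
  "algorithm_for Q V p G \<longleftrightarrow>
     algorithm Q V G \<and> (\<forall>x \<in> V \<rightarrow>\<^sub>E UNIV. p_comp G x (\<lambda>_. 0) = p x)"

definition accurate_on ::
  "('v \<Rightarrow> real) set \<Rightarrow> (('v \<Rightarrow> real) \<Rightarrow> real) \<Rightarrow> 'v graph \<Rightarrow> bool" where
  "accurate_on D p G \<longleftrightarrow>
     (\<forall>\<eta>. 0 < \<eta> \<and> \<eta> < 1 \<longrightarrow>
       (\<exists>\<epsilon>. 0 < \<epsilon> \<and> \<epsilon> < 1 \<and>
         (\<forall>x \<in> D. \<forall>\<delta>. (\<forall>i < length G. \<bar>\<delta> i\<bar> \<le> \<epsilon>) \<longrightarrow>
            \<bar>p_comp G x \<delta> - p x\<bar> \<le> \<eta> * \<bar>p x\<bar>)))"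

text \<open>The polynomial p is given by its values, which determine it over the reals.\<close>

definition accurately_evaluable ::
  "blackbox set \<Rightarrow> 'v set \<Rightarrow> ('v \<Rightarrow> real) set \<Rightarrow> (('v \<Rightarrow> real) \<Rightarrow> real) \<Rightarrow> bool" where
  "accurately_evaluable Q V D p \<longleftrightarrow> (\<exists>G. algorithm_for Q V p G \<and> accurate_on D p G)"

definition toeplitz_mat :: "nat \<Rightarrow> (int \<Rightarrow> real) \<Rightarrow> real mat" where
  "toeplitz_mat n x = mat n n (\<lambda>(i, j). x (int j - int i))"

end

theory Submission imports Defs "Jordan_Normal_Form.Char_Poly" begin

text \<open>
  Let the black boxes have degree at most \<open>d\<close>, where \<open>1 \<le> d\<close>, and let \<open>n > d\<close>. Suppose that
  an algorithm is accurate for the determinant of \<open>n\<close>-by-\<open>n\<close> Toeplitz matrices.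
  Relative accuracy forces its output to be 0 at every singular \<open>x0\<close>, for all small rounding
  errors. The contradiction comes from a singular \<open>x0\<close> that the algorithm cannot
  distinguish from the nonsingular matrices near it.

  Since every nonzero result of a computational node is multiplied by its own factor
  \<open>1 + \<delta>\<close>, it can be moved freely in a small interval. So these results act as
  independent variables \<open>z\<close>, and the next value (a black box, or the difference of two compared
  operands, or the output) is a polynomial in the input \<open>x\<close> and in \<open>z\<close>, of degree at most
  \<open>d\<close> in \<open>x\<close>. Only finitely many such polynomials occur, as there are finitely many nodes and
  finitely many sets of nodes that may hold a nonzero result. Call \<open>x0\<close> generic if
  none of them, except the zero polynomial, vanishes identically in \<open>z\<close> at
  \<open>x0\<close>. At a generic \<open>x0\<close> the rounding errors can be chosen such that a value is 0 only if its
  polynomial is 0; then all comparisons that are not forced to be ties are strict, and the same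
  path is followed near \<open>x0\<close>. An output that is 0 at \<open>x0\<close> is therefore 0
  for certain small errors at each nearby \<open>x\<close> too (\<open>run_at_generic_point\<close>). But
  \<open>T + t I\<close> is nonsingular for all but finitely many \<open>t\<close>
  (\<open>finite_det_toeplitz_diagonal_shift\<close>).

  It remains to find a singular \<open>x0\<close> that is generic. Sequences \<open>x\<close> that are sums of \<open>d\<close> geometric
  progressions give Toeplitz matrices of rank at most \<open>d < n\<close>
  (\<open>det_toeplitz_geometric_sum\<close>). Geometrically, they are the points on the secant spaces
  spanned by \<open>d\<close> points of a rational normal curve, and no nonzero polynomial of degree at most \<open>d\<close>
  vanishes on all of them (\<open>diff_degree_le_zero_on_geometric_sums\<close>). As they
  are parametrized polynomially by an affine space, finitely many nonzero polynomials of degree at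
  most \<open>d\<close> have a common nonroot among them (\<open>common_nonroot\<close>).
\<close>

section \<open>Univariate polynomial functions\<close>

lemma range_poly_const: "(\<lambda>t. c) \<in> range poly"
  by (rule range_eqI[of _ _ "[:c:]"]) auto

lemma range_poly_ident: "(\<lambda>t::'a::comm_semiring_1. t) \<in> range poly"
  by (rule range_eqI[of _ _ "[:0, 1:]"]) auto

lemma range_poly_add:
  assumes "f \<in> range poly" "g \<in> range poly"
  shows "(\<lambda>t. f t + g t) \<in> range poly"
proof -
  from assms obtain p q where "f = poly p" "g = poly q" by auto
  then show ?thesis by (intro range_eqI[of _ _ "p + q"]) auto
qed

lemma range_poly_mult:
  fixes f g :: "'a::comm_semiring_1 \<Rightarrow> 'a"
  assumes "f \<in> range poly" "g \<in> range poly"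
  shows "(\<lambda>t. f t * g t) \<in> range poly"
proof -
  from assms obtain p q where "f = poly p" "g = poly q" by auto
  then show ?thesis by (intro range_eqI[of _ _ "p * q"]) auto
qed

lemma range_poly_uminus:
  fixes f :: "'a::comm_ring_1 \<Rightarrow> 'a"
  assumes "f \<in> range poly"
  shows "(\<lambda>t. - f t) \<in> range poly"
  using range_poly_mult[OF range_poly_const[of "-1"] assms] by simp

lemma range_poly_diff:
  fixes f g :: "'a::comm_ring_1 \<Rightarrow> 'a"
  assumes "f \<in> range poly" "g \<in> range poly"
  shows "(\<lambda>t. f t - g t) \<in> range poly"
  using range_poly_add[OF assms(1) range_poly_uminus[OF assms(2)]] by simp

lemma range_poly_power:
  fixes f :: "'a::comm_semiring_1 \<Rightarrow> 'a"
  assumes "f \<in> range poly"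
  shows "(\<lambda>t. f t ^ k) \<in> range poly"
  by (induction k) (simp_all add: range_poly_const range_poly_mult assms)

lemma range_poly_sum:
  assumes "\<And>a. a \<in> A \<Longrightarrow> f a \<in> range poly"
  shows "(\<lambda>t. \<Sum>a\<in>A. f a t) \<in> range poly"
  using assms
  by (induction A rule: infinite_finite_induct) (simp_all add: range_poly_const range_poly_add)

lemma range_poly_prod:
  fixes f :: "'b \<Rightarrow> 'a::comm_semiring_1 \<Rightarrow> 'a"
  assumes "\<And>a. a \<in> A \<Longrightarrow> f a \<in> range poly"
  shows "(\<lambda>t. \<Prod>a\<in>A. f a t) \<in> range poly"
  using assms
  by (induction A rule: infinite_finite_induct) (simp_all add: range_poly_const range_poly_mult)

lemma finite_roots_range_poly:
  fixes f :: "'a::idom \<Rightarrow> 'a"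
  assumes "f \<in> range poly" "f t0 \<noteq> 0"
  shows "finite {t. f t = 0}"
proof -
  from assms obtain p where p: "f = poly p" by auto
  with assms have "p \<noteq> 0" by auto
  with p show ?thesis by (simp add: poly_roots_finite)
qed

lemma tendsto_range_poly:
  fixes f :: "real \<Rightarrow> real"
  assumes "f \<in> range poly"
  shows "(f \<longlongrightarrow> f a) (nhds a)"
proof -
  from assms obtain p where p: "f = poly p" by auto
  show ?thesis
    unfolding p using poly_isCont[of a p]
    by (simp add: isCont_def tendsto_at_iff_tendsto_nhds)
qed

lemma range_poly_mpoly_eval:
  assumes "\<And>i. i \<in> mpoly_vars q \<Longrightarrow> (\<lambda>t. h t i) \<in> range poly"
  shows "(\<lambda>t. mpoly_eval q (h t)) \<in> range poly"
  unfolding mpoly_eval_def using assms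
  by (intro range_poly_sum range_poly_mult range_poly_const range_poly_prod range_poly_power)
     (auto simp: mpoly_vars_def)

text \<open>
  On the line through a common nonroot of the old functions and a nonroot of the new one, each
  function is a nonzero univariate polynomial, so all but finitely many points of the line serve.
\<close>

lemma common_nonroot:
  fixes H :: "(('i \<Rightarrow> real) \<Rightarrow> real) set"
  assumes "finite H"
    and "\<And>h a b. h \<in> H \<Longrightarrow> (\<lambda>t. h (\<lambda>i. a i + t * (b i - a i))) \<in> range poly"
    and "\<And>h. h \<in> H \<Longrightarrow> \<exists>a. h a \<noteq> 0"
  shows "\<exists>a. \<forall>h \<in> H. h a \<noteq> 0"
  using assms
proof (induction H rule: finite_induct)
  case empty
  then show ?case by simp
next
  case (insert h H)
  have "\<exists>a. \<forall>h \<in> H. h a \<noteq> 0" by (rule insert.IH) (blast intro: insert.prems)+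
  then obtain a where a: "\<forall>h \<in> H. h a \<noteq> 0" by blast
  obtain b where b: "h b \<noteq> 0" using insert.prems(2) by blast
  define c where "c t = (\<lambda>i. a i + t * (b i - a i))" for t :: real
  have fin: "finite {t. g (c t) = 0}" if g: "g \<in> insert h H" for g
  proof -
    have "(\<lambda>t. g (c t)) \<in> range poly" using insert.prems(1)[OF g] by (simp add: c_def)
    moreover have "g (c 0) \<noteq> 0 \<or> g (c 1) \<noteq> 0" using g a b by (auto simp: c_def)
    ultimately show ?thesis using finite_roots_range_poly by blast
  qed
  have "finite (\<Union>g \<in> insert h H. {t. g (c t) = 0})"
    using fin insert.hyps(1) by blast
  then obtain t where "t \<notin> (\<Union>g \<in> insert h H. {t. g (c t) = 0})"
    using ex_new_if_finite[OF infinite_UNIV_char_0] by blast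
  then show ?case by (intro exI[of _ "c t"]) auto
qed

section \<open>Degree bounds through iterated differences\<close>

text \<open>
  A polynomial of degree at most \<open>Suc d\<close> has differences \<open>f (x + u) - f x\<close> of degree at most \<open>d\<close>.
  This step is what the induction on degrees below rests on; as a definition it makes
  sense in any set of variables and avoids coefficients.
\<close>

primrec diff_degree_le :: "nat \<Rightarrow> (('v \<Rightarrow> real) \<Rightarrow> real) \<Rightarrow> bool" where
  "diff_degree_le 0 f \<longleftrightarrow> (\<exists>c. f = (\<lambda>x. c))"
| "diff_degree_le (Suc d) f \<longleftrightarrow> (\<forall>u. diff_degree_le d (\<lambda>x. f (\<lambda>v. x v + u v) - f x))"

lemma diff_degree_le_const: "diff_degree_le d (\<lambda>x. c)"
  by (induction d arbitrary: c) auto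

lemma diff_degree_le_Suc: "diff_degree_le d f \<Longrightarrow> diff_degree_le (Suc d) f"
proof (induction d arbitrary: f)
  case 0
  then show ?case by auto
next
  case (Suc d)
  show ?case
    by (subst diff_degree_le.simps(2), intro allI, rule Suc.IH) (use Suc.prems in simp)
qed

lemma diff_degree_le_mono: "diff_degree_le d f \<Longrightarrow> d \<le> e \<Longrightarrow> diff_degree_le e f"
  by (rule dec_induct[of d e]) (auto intro: diff_degree_le_Suc simp del: diff_degree_le.simps)

lemma diff_degree_le_add:
  "diff_degree_le d f \<Longrightarrow> diff_degree_le d g \<Longrightarrow> diff_degree_le d (\<lambda>x. f x + g x)"
proof (induction d arbitrary: f g)
  case 0
  then show ?case by auto
next
  case (Suc d)
  show ?case
  proof (subst diff_degree_le.simps, intro allI)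
    fix u
    have "diff_degree_le d (\<lambda>x. (f (\<lambda>v. x v + u v) - f x) + (g (\<lambda>v. x v + u v) - g x))"
      using Suc by simp
    then show "diff_degree_le d (\<lambda>x. (f (\<lambda>v. x v + u v) + g (\<lambda>v. x v + u v)) - (f x + g x))"
      by (simp add: algebra_simps)
  qed
qed

lemma diff_degree_le_cmult: "diff_degree_le d f \<Longrightarrow> diff_degree_le d (\<lambda>x. c * f x)"
proof (induction d arbitrary: f)
  case 0
  then show ?case by auto
next
  case (Suc d)
  show ?case
  proof (subst diff_degree_le.simps, intro allI)
    fix u
    have "diff_degree_le d (\<lambda>x. c * (f (\<lambda>v. x v + u v) - f x))"
      using Suc by simp
    then show "diff_degree_le d (\<lambda>x. c * f (\<lambda>v. x v + u v) - c * f x)"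
      by (simp add: algebra_simps)
  qed
qed

text \<open>
  The difference of a product is \<open>F * G + f * G + F * g\<close>, where \<open>F\<close> and \<open>G\<close> are the differences
  of the factors \<open>f\<close> and \<open>g\<close>; each summand has a smaller sum of degree bounds.
\<close>

lemma diff_degree_le_mult:
  "diff_degree_le a f \<Longrightarrow> diff_degree_le b g \<Longrightarrow> diff_degree_le (a + b) (\<lambda>x. f x * g x)"
proof (induction "a + b" arbitrary: a b f g rule: less_induct)
  case less
  consider "a = 0" | "b = 0" | a' b' where "a = Suc a'" "b = Suc b'"
    by (cases a; cases b) auto
  then show ?case
  proof cases
    case 1
    with less.prems(1) obtain c where "f = (\<lambda>x. c)" by auto
    then show ?thesis using diff_degree_le_cmult[OF less.prems(2)] 1 by simp
  next
    case 2
    with less.prems(2) obtain c where "g = (\<lambda>x. c)" by auto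
    then show ?thesis using diff_degree_le_cmult[OF less.prems(1)] 2 by (simp add: mult.commute)
  next
    case 3
    have "diff_degree_le (Suc (a' + b')) (\<lambda>x. f (\<lambda>v. x v + u v) * g (\<lambda>v. x v + u v) - f x * g x)"
      for u
    proof -
      define F where "F x = f (\<lambda>v. x v + u v) - f x" for x
      define G where "G x = g (\<lambda>v. x v + u v) - g x" for x
      have F: "diff_degree_le a' F" and G: "diff_degree_le b' G"
        using less.prems 3 by (auto simp: F_def[abs_def] G_def[abs_def])
      have "diff_degree_le (Suc (a' + b')) (\<lambda>x. F x * G x)"
        using less.hyps[OF _ F G] 3 diff_degree_le_Suc by simp
      moreover have "diff_degree_le (Suc (a' + b')) (\<lambda>x. f x * G x)"
        using less.hyps[OF _ less.prems(1) G] 3 by simp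
      moreover have "diff_degree_le (Suc (a' + b')) (\<lambda>x. F x * g x)"
        using less.hyps[OF _ F less.prems(2)] 3 by simp
      ultimately have "diff_degree_le (Suc (a' + b')) (\<lambda>x. F x * G x + (f x * G x + F x * g x))"
        by (intro diff_degree_le_add)
      then show ?thesis
        by (simp add: F_def G_def algebra_simps)
    qed
    then show ?thesis using 3 by simp
  qed
qed

declare diff_degree_le.simps [simp del]

lemma diff_degree_le_sum:
  assumes "\<And>a. a \<in> A \<Longrightarrow> diff_degree_le d (f a)"
  shows "diff_degree_le d (\<lambda>x. \<Sum>a\<in>A. f a x)"
  using assms
  by (induction A rule: infinite_finite_induct)
     (simp_all add: diff_degree_le_const diff_degree_le_add)

lemma diff_degree_le_power:
  assumes "diff_degree_le 1 f"
  shows "diff_degree_le k (\<lambda>x. f x ^ k)"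
proof (induction k)
  case (Suc k)
  then show ?case using diff_degree_le_mult[OF assms Suc] by simp
qed (simp add: diff_degree_le_const)

lemma diff_degree_le_prod:
  assumes "finite A" "\<And>a. a \<in> A \<Longrightarrow> diff_degree_le (d a) (f a)"
  shows "diff_degree_le (\<Sum>a\<in>A. d a) (\<lambda>x. \<Prod>a\<in>A. f a x)"
  using assms
proof (induction A rule: finite_induct)
  case (insert a A)
  then show ?case
    using diff_degree_le_mult[of "d a" "f a" "sum d A" "\<lambda>x. \<Prod>a\<in>A. f a x"] by simp
qed (simp add: diff_degree_le_const)

lemma diff_degree_le_coordinate: "diff_degree_le 1 (\<lambda>x. x v)"
  by (auto simp: diff_degree_le.simps)

lemma diff_degree_le_mpoly_eval:
  assumes "\<And>i. i \<in> mpoly_vars q \<Longrightarrow> diff_degree_le 1 (\<lambda>x. h x i)"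
  shows "diff_degree_le (total_degree q) (\<lambda>x. mpoly_eval q (h x))"
  unfolding mpoly_eval_def
proof (intro diff_degree_le_sum diff_degree_le_cmult)
  fix m assume m: "m \<in> Poly_Mapping.keys q"
  have "diff_degree_le (monomial_degree m)
     (\<lambda>x. \<Prod>i\<in>Poly_Mapping.keys m. h x i ^ Poly_Mapping.lookup m i)"
    unfolding monomial_degree_def using m assms
    by (intro diff_degree_le_prod diff_degree_le_power) (auto simp: mpoly_vars_def)
  moreover have "monomial_degree m \<le> total_degree q"
    unfolding total_degree_def using m by (intro Max_ge) auto
  ultimately show "diff_degree_le (total_degree q)
     (\<lambda>x. \<Prod>i\<in>Poly_Mapping.keys m. h x i ^ Poly_Mapping.lookup m i)"
    by (rule diff_degree_le_mono)
qed

section \<open>Sums of geometric progressions\<close>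

text \<open>
  The \<open>d\<close> factors and the \<open>d\<close> ratios are the even and the odd entries of one parameter vector, so
  that lines in the parameter space need no pairs. The exponents \<open>e\<close> are natural numbers,
  which keeps the entries polynomial in the ratios, with 0 allowed as a ratio.
\<close>

definition geometric_sum :: "('v \<Rightarrow> nat) \<Rightarrow> nat \<Rightarrow> (nat \<Rightarrow> real) \<Rightarrow> 'v \<Rightarrow> real" where
  "geometric_sum e d w v = (\<Sum>l<d. w (2 * l) * w (2 * l + 1) ^ e v)"

lemma geometric_sum_Suc:
  "geometric_sum e (Suc d) (w(2 * d := c, 2 * d + 1 := a)) v = geometric_sum e d w v + c * a ^ e v"
proof -
  have "(\<Sum>l<d. (w(2 * d := c, 2 * d + 1 := a)) (2 * l) * (w(2 * d := c, 2 * d + 1 := a)) (2 * l + 1) ^ e v)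
      = geometric_sum e d w v"
    unfolding geometric_sum_def by (intro sum.cong) auto
  then show ?thesis by (simp add: geometric_sum_def)
qed

text \<open>
  A linear subspace that contains all values of a vector-valued polynomial contains its
  coefficients. Comparing the values at \<open>2 * a\<close> and at \<open>a\<close> eliminates the leading coefficient and
  rescales the others by nonzero factors.
\<close>

lemma coefficients_from_values:
  fixes P :: "('v \<Rightarrow> real) \<Rightarrow> bool" and b :: "nat \<Rightarrow> 'v \<Rightarrow> real"
  assumes lin: "\<And>r s u v. P u \<Longrightarrow> P v \<Longrightarrow> P (\<lambda>i. r * u i + s * v i)"
    and val: "\<And>a. P (\<lambda>i. \<Sum>k<N. a ^ k * b k i)"
    and "k < N"
  shows "P (b k)"
  using val \<open>k < N\<close>
proof (induction N arbitrary: b k)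
  case 0
  then show ?case by simp
next
  case (Suc N)
  have "P (\<lambda>i. \<Sum>k<N. a ^ k * ((2 ^ k - 2 ^ N) * b k i))" for a
  proof -
    have "P (\<lambda>i. 1 * (\<Sum>k<Suc N. (2 * a) ^ k * b k i) + (- (2 ^ N)) * (\<Sum>k<Suc N. a ^ k * b k i))"
      by (intro lin Suc.prems)
    also have "(\<lambda>i. 1 * (\<Sum>k<Suc N. (2 * a) ^ k * b k i) + (- (2 ^ N)) * (\<Sum>k<Suc N. a ^ k * b k i))
       = (\<lambda>i. \<Sum>k<N. a ^ k * ((2 ^ k - 2 ^ N) * b k i))"
      by (simp add: fun_eq_iff sum_distrib_left power_mult_distrib algebra_simps sum_subtractf sum_negf)
    finally show ?thesis .
  qed
  then have scaled: "P (\<lambda>i. (2 ^ k - 2 ^ N) * b k i)" if "k < N" for k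
    using Suc.IH[of "\<lambda>k i. (2 ^ k - 2 ^ N) * b k i"] that by blast
  have low: "P (b k)" if "k < N" for k
  proof -
    have "P (\<lambda>i. inverse (2 ^ k - 2 ^ N) * ((2 ^ k - 2 ^ N) * b k i)
        + 0 * ((2 ^ k - 2 ^ N) * b k i))"
      using scaled[OF that] by (intro lin)
    moreover have "(2::real) ^ k - 2 ^ N \<noteq> 0" using that by simp
    ultimately show ?thesis by (simp add: mult.assoc[symmetric])
  qed
  have part: "P (\<lambda>i. \<Sum>k<M. b k i)" if "M \<le> N" for M
    using that
  proof (induction M)
    case 0
    show ?case using lin[OF Suc.prems(1)[of 0] Suc.prems(1)[of 0], of 0 0] by simp
  next
    case (Suc M)
    then show ?case using lin[of "\<lambda>i. \<Sum>k<M. b k i" "b M" 1 1] low[of M] by simp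
  qed
  have "P (\<lambda>i. 1 * (\<Sum>k<Suc N. 1 ^ k * b k i) + (- 1) * (\<Sum>k<N. b k i))"
    by (rule lin[OF Suc.prems(1) part[OF order_refl]])
  then have "P (b N)" by simp
  with low Suc.prems(2) show ?case by (metis less_SucE)
qed

text \<open>
  Adding one more geometric progression \<open>u\<close> to a sum of \<open>d\<close> of them gives a sum of \<open>Suc d\<close>, so the
  difference of \<open>f\<close> in direction \<open>u\<close> vanishes on all sums of \<open>d\<close>. By induction it is 0 everywhere,
  that is, \<open>u\<close> is a period of \<open>f\<close>. All real multiples of \<open>u\<close> are periods too, and since the exponents
  are distinct on \<open>V\<close>, the geometric progressions span all directions in \<open>V\<close>. Hence \<open>f\<close> is constant.
\<close>

lemma diff_degree_le_zero_on_geometric_sums: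
  fixes e :: "'v \<Rightarrow> nat"
  assumes "diff_degree_le d f"
    and "\<And>w. f (geometric_sum e d w) = 0"
    and V: "finite V" "inj_on e V"
    and dep: "\<And>x y. (\<And>v. v \<in> V \<Longrightarrow> x v = y v) \<Longrightarrow> f x = f y"
  shows "f x = 0"
  using assms(1,2) dep
proof (induction d arbitrary: f x)
  case 0
  from "0.prems"(1) obtain c where "f = (\<lambda>x. c)" by (auto simp: diff_degree_le.simps)
  then show ?case using "0.prems"(2) by simp
next
  case (Suc d)
  \<comment> \<open>The directions in which all translations leave \<open>f\<close> invariant form a subspace.\<close>
  define P where "P u \<longleftrightarrow> (\<forall>c x. f (\<lambda>v. x v + c * u v) = f x)" for u
  have geo: "P (\<lambda>v. a ^ e v)" for a
    unfolding P_def
  proof (intro allI)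
    fix c x
    define g where "g x = f (\<lambda>v. x v + c * a ^ e v) - f x" for x
    have "g x = 0"
    proof (rule Suc.IH[of g x])
      show "diff_degree_le d g" using Suc.prems(1) by (simp add: g_def[abs_def] diff_degree_le.simps)
    next
      fix w
      have "f (\<lambda>v. geometric_sum e d w v + c * a ^ e v) = 0" for c
      proof -
        have "geometric_sum e (Suc d) (w(2 * d := c, 2 * d + 1 := a)) =
            (\<lambda>v. geometric_sum e d w v + c * a ^ e v)"
          by (rule ext) (rule geometric_sum_Suc)
        then show ?thesis using Suc.prems(2)[of "w(2 * d := c, 2 * d + 1 := a)"] by (simp only:)
      qed
      from this[of c] this[of 0] show "g (geometric_sum e d w) = 0" by (simp add: g_def)
    next
      fix x y :: "'v \<Rightarrow> real" assume "\<And>v. v \<in> V \<Longrightarrow> x v = y v"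
      then show "g x = g y"
        unfolding g_def by (intro arg_cong2[where f = "(-)"] Suc.prems(3)) auto
    qed
    then show "f (\<lambda>v. x v + c * a ^ e v) = f x" by (simp add: g_def)
  qed
  have lin: "P (\<lambda>i. r * u i + s * v i)" if "P u" "P v" for r s u v
    unfolding P_def
  proof (intro allI)
    fix c x
    have "f (\<lambda>i. x i + c * (r * u i + s * v i)) = f (\<lambda>i. (x i + (c * r) * u i) + (c * s) * v i)"
      by (simp add: algebra_simps)
    also have "\<dots> = f x" using that by (simp add: P_def)
    finally show "f (\<lambda>i. x i + c * (r * u i + s * v i)) = f x" .
  qed
  define N where "N = Suc (Max (insert 0 (e ` V)))"
  have e_less: "e v < N" if "v \<in> V" for v
    unfolding N_def using V(1) that by (simp add: le_imp_less_Suc)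
  \<comment> \<open>As a polynomial in its ratio, a geometric progression has the unit vectors as coefficients.\<close>
  define b :: "nat \<Rightarrow> 'v \<Rightarrow> real" where "b k v = (if v \<in> V \<and> e v = k then 1 else 0)" for k v
  have "P (\<lambda>v. \<Sum>k<N. a ^ k * b k v)" for a
  proof -
    have "f (\<lambda>v. x v + c * (\<Sum>k<N. a ^ k * b k v)) = f (\<lambda>v. x v + c * a ^ e v)" for c x
    proof (rule Suc.prems(3))
      fix v assume "v \<in> V"
      then have "(\<Sum>k<N. a ^ k * b k v) = (\<Sum>k<N. if k = e v then a ^ e v else 0)"
        by (intro sum.cong) (auto simp: b_def)
      then show "x v + c * (\<Sum>k<N. a ^ k * b k v) = x v + c * a ^ e v"
        using e_less[OF \<open>v \<in> V\<close>] by simp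
    qed
    then show ?thesis using geo by (simp add: P_def)
  qed
  then have Pb: "P (b k)" if "k < N" for k
    using coefficients_from_values[where P = P and N = N and b = b, OF lin _ that] by blast
  have upd: "f (x(v := s)) = f x" if v: "v \<in> V" for v s and x :: "'v \<Rightarrow> real"
  proof -
    have "f (\<lambda>i. x i + (s - x v) * b (e v) i) = f x"
      using Pb[OF e_less[OF v]] by (simp add: P_def)
    moreover have "(\<lambda>i. x i + (s - x v) * b (e v) i) = x(v := s)"
      using v V(2) by (auto simp: b_def fun_eq_iff inj_on_def)
    ultimately show ?thesis by simp
  qed
  have "f (\<lambda>v. if v \<in> A then 0 else x v) = f x" if "A \<subseteq> V" for A
    using finite_subset[OF that V(1)] that
  proof (induction A rule: finite_induct)
    case (insert a A)
    have "(\<lambda>v. if v \<in> insert a A then 0 else x v) = (\<lambda>v. if v \<in> A then 0 else x v)(a := 0)"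
      by auto
    then show ?case using insert upd by simp
  qed simp
  from this[OF subset_refl] have "f x = f (\<lambda>v. if v \<in> V then 0 else x v)" by simp
  also have "\<dots> = f (geometric_sum e (Suc d) (\<lambda>_. 0))"
    by (rule Suc.prems(3)) (simp add: geometric_sum_def)
  also have "\<dots> = 0" by (rule Suc.prems(2))
  finally show ?case .
qed

section \<open>Singular Toeplitz matrices\<close>

text \<open>
  A sum of \<open>d\<close> geometric progressions satisfies the linear recurrence whose characteristic
  polynomial \<open>p\<close> has the \<open>d\<close> ratios as roots. As \<open>d < n\<close>, the coefficients of \<open>p\<close> form a nonzero
  vector in the kernel of the matrix.
\<close>

lemma det_toeplitz_geometric_sum:
  assumes "d < n" and e: "\<And>k. k \<in> {1 - int n..int n - 1} \<Longrightarrow> e k = nat (k + int n - 1)"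
    and x: "\<And>k. k \<in> {1 - int n..int n - 1} \<Longrightarrow> x k = geometric_sum e d w k"
  shows "Determinant.det (toeplitz_mat n x) = 0"
proof -
  define p where "p = (\<Prod>l<d. [:- w (2 * l + 1), 1:])"
  define c where "c = vec n (coeff p)"
  have deg: "degree p = d" unfolding p_def by (simp add: degree_prod_eq_sum_degree)
  have "monic p" unfolding p_def lead_coeff_prod by simp
  have root: "poly p (w (2 * l + 1)) = 0" if "l < d" for l
    unfolding p_def poly_prod using that by (intro prod_zero) auto
  have T: "toeplitz_mat n x \<in> carrier_mat n n" by (simp add: toeplitz_mat_def)
  have "c $ d \<noteq> 0" using deg \<open>monic p\<close> \<open>d < n\<close> by (simp add: c_def)
  then have "c \<noteq> 0\<^sub>v n" using \<open>d < n\<close> by auto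
  moreover have "toeplitz_mat n x *\<^sub>v c = 0\<^sub>v n"
  proof (rule eq_vecI)
    fix i assume "i < dim_vec (0\<^sub>v n :: real vec)"
    then have i: "i < n" by simp
    have "(toeplitz_mat n x *\<^sub>v c) $ i = (\<Sum>j<n. x (int j - int i) * coeff p j)"
      using i by (simp add: toeplitz_mat_def c_def scalar_prod_def atLeast0LessThan)
    also have "\<dots> = (\<Sum>j<n. \<Sum>l<d. w (2 * l) * w (2 * l + 1) ^ (n - 1 - i) * (coeff p j * w (2 * l + 1) ^ j))"
    proof (intro sum.cong refl)
      fix j assume "j \<in> {..<n}"
      then have j: "int j - int i \<in> {1 - int n..int n - 1}" and "nat (int j - int i + int n - 1) = n - 1 - i + j"
        using i by auto
      then show "x (int j - int i) * coeff p j =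
          (\<Sum>l<d. w (2 * l) * w (2 * l + 1) ^ (n - 1 - i) * (coeff p j * w (2 * l + 1) ^ j))"
        by (simp add: x[OF j] e[OF j] geometric_sum_def sum_distrib_left power_add algebra_simps)
    qed
    also have "\<dots> = (\<Sum>l<d. w (2 * l) * w (2 * l + 1) ^ (n - 1 - i) * (\<Sum>j<n. coeff p j * w (2 * l + 1) ^ j))"
      by (subst sum.swap) (simp add: sum_distrib_left)
    also have "\<dots> = (\<Sum>l<d. w (2 * l) * w (2 * l + 1) ^ (n - 1 - i) * poly p (w (2 * l + 1)))"
    proof (intro sum.cong refl arg_cong2[where f = "(*)"])
      fix l
      show "(\<Sum>j<n. coeff p j * w (2 * l + 1) ^ j) = poly p (w (2 * l + 1))"
        unfolding poly_altdef using deg \<open>d < n\<close>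
        by (intro sum.mono_neutral_right) (auto simp: coeff_eq_0)
    qed
    also have "\<dots> = 0" using root by simp
    finally show "(toeplitz_mat n x *\<^sub>v c) $ i = 0\<^sub>v n $ i" using i by simp
  qed (simp add: toeplitz_mat_def)
  ultimately show ?thesis
    unfolding det_0_iff_vec_prod_zero[OF T] by (intro exI[of _ c]) (simp add: c_def)
qed

text \<open>
  The determinant is 0 exactly if \<open>- t\<close> is an eigenvalue of the unshifted matrix.
\<close>

lemma finite_det_toeplitz_diagonal_shift:
  "finite {t. Determinant.det (toeplitz_mat n (x(0 := x 0 + t))) = 0}"
proof -
  let ?T = "toeplitz_mat n x"
  have T: "?T \<in> carrier_mat n n" by (simp add: toeplitz_mat_def)
  have "toeplitz_mat n (x(0 := x 0 + t)) = char_matrix ?T (- t)" for t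
    by (rule eq_matI) (auto simp: toeplitz_mat_def char_matrix_def)
  then have "{t. Determinant.det (toeplitz_mat n (x(0 := x 0 + t))) = 0}
      = uminus ` {s. poly (char_poly ?T) s = 0}"
    by (force simp: eigenvalue_det[OF T, symmetric] eigenvalue_root_char_poly[OF T] image_iff)
  moreover have "char_poly ?T \<noteq> 0" using degree_monic_char_poly[OF T] by auto
  ultimately show ?thesis by (simp add: poly_roots_finite)
qed

section \<open>Executions at a generic point\<close>

text \<open>
  Unlike the environment of an execution, the results \<open>z\<close> of the nodes are total here and are
  free variables, independent of the input \<open>x\<close>.
\<close>

primrec operand_val :: "('v \<Rightarrow> real) \<Rightarrow> (nat \<Rightarrow> real) \<Rightarrow> 'v operand \<Rightarrow> real" where
  "operand_val x z (Inp v) = x v"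
| "operand_val x z (Res i) = z i"
| "operand_val x z (Neg a) = - operand_val x z a"

text \<open>
  The quantity of a node whose vanishing matters: a product with \<open>1 + \<delta>\<close> can be
  varied only if the other factor is nonzero, and a comparison depends on the
  sign of the difference of its operands.
\<close>

primrec node_val :: "('v \<Rightarrow> real) \<Rightarrow> (nat \<Rightarrow> real) \<Rightarrow> 'v node \<Rightarrow> real" where
  "node_val x z (Compute b args j) = apply_blackbox b (map (operand_val x z) args)"
| "node_val x z (Branch c a b j k) = operand_val x z a - operand_val x z b"
| "node_val x z (Output a) = operand_val x z a"

text \<open>
  At a generic point the executed computational nodes split into those in \<open>S\<close>, whose results
  are varied freely, and those whose result is 0 for all inputs.
\<close>

definition zero_outside :: "nat set \<Rightarrow> (nat \<Rightarrow> real) \<Rightarrow> nat \<Rightarrow> real" where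
  "zero_outside S z i = (if i \<in> S then z i else 0)"

lemma operand_value_eq:
  assumes "operand_value x env a = Some s" "env \<subseteq>\<^sub>m Some \<circ> z"
  shows "operand_value x' env a = Some (operand_val x' z a)"
  using assms
proof (induction a arbitrary: s)
  case (Res i)
  then show ?case by (auto simp: map_le_def dom_def)
qed auto

lemma operand_values_eq:
  assumes "map (operand_value x env) args = map Some vals" "env \<subseteq>\<^sub>m Some \<circ> z"
  shows "map (operand_value x' env) args = map Some (map (operand_val x' z) args)"
proof -
  have "operand_value x' env a = Some (operand_val x' z a)" if "a \<in> set args" for a
  proof -
    from that have "operand_value x env a \<in> Some ` set vals"
      by (metis assms(1) image_eqI set_map)
    then show ?thesis using operand_value_eq[OF _ assms(2)] by auto
  qed
  then show ?thesis by simp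
qed

lemma operand_val_cong:
  "(\<And>v. v \<in> operand_inputs a \<Longrightarrow> x v = y v) \<Longrightarrow> operand_val x z a = operand_val y z a"
  by (induction a) auto

lemma node_val_cong:
  "(\<And>v. v \<in> node_inputs m \<Longrightarrow> x v = y v) \<Longrightarrow> node_val x z m = node_val y z m"
proof (cases m)
  case (Compute b args j)
  assume "\<And>v. v \<in> node_inputs m \<Longrightarrow> x v = y v"
  then have "operand_val x z a = operand_val y z a" if "a \<in> set args" for a
    using that by (intro operand_val_cong) (auto simp: Compute)
  then show ?thesis by (simp add: Compute cong: map_cong)
qed (simp_all add: operand_val_cong[of _ x y])

lemma range_poly_operand_val:
  assumes "\<And>v. (\<lambda>t. x t v) \<in> range poly" "\<And>i. (\<lambda>t. z t i) \<in> range poly"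
  shows "(\<lambda>t. operand_val (x t) (z t) a) \<in> range poly"
  by (induction a) (simp_all add: assms range_poly_uminus)

lemma range_poly_node_val:
  assumes "node_ok Q G i m" "\<forall>b\<in>Q. is_blackbox b"
    and "\<And>v. (\<lambda>t. x t v) \<in> range poly" "\<And>i. (\<lambda>t. z t i) \<in> range poly"
  shows "(\<lambda>t. node_val (x t) (z t) m) \<in> range poly"
proof (cases m)
  case (Compute b args j)
  have "(\<lambda>t. map (operand_val (x t) (z t)) args ! i) \<in> range poly" if "i \<in> mpoly_vars (snd b)" for i
  proof -
    have "i < length args" using assms(1,2) Compute that by (auto simp: is_blackbox_def)
    then show ?thesis using range_poly_operand_val[OF assms(3,4)] by simp
  qed
  then show ?thesis by (simp add: Compute apply_blackbox_def range_poly_mpoly_eval)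
qed (simp_all add: range_poly_operand_val range_poly_diff assms)

lemma diff_degree_le_operand_val: "diff_degree_le 1 (\<lambda>x. operand_val x z a)"
proof (induction a)
  case (Neg a)
  then show ?case using diff_degree_le_cmult[OF Neg, of "-1"] by simp
qed (simp_all del: One_nat_def add: diff_degree_le_coordinate diff_degree_le_const)

lemma diff_degree_le_node_val:
  assumes "node_ok Q G i m" "\<forall>b\<in>Q. is_blackbox b" "\<forall>b\<in>Q. total_degree (snd b) \<le> d" "1 \<le> d"
  shows "diff_degree_le d (\<lambda>x. node_val x z m)"
proof (cases m)
  case (Compute b args j)
  have "diff_degree_le 1 (\<lambda>x. map (operand_val x z) args ! i)" if "i \<in> mpoly_vars (snd b)" for i
  proof -
    have "i < length args" using assms(1,2) Compute that by (auto simp: is_blackbox_def)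
    then show ?thesis using diff_degree_le_operand_val by simp
  qed
  then have "diff_degree_le (total_degree (snd b)) (\<lambda>x. node_val x z m)"
    by (simp add: Compute apply_blackbox_def diff_degree_le_mpoly_eval)
  then show ?thesis using assms(1,3) Compute diff_degree_le_mono by auto
next
  case (Branch c a b j k)
  have "diff_degree_le 1 (\<lambda>x. operand_val x z a + (- 1) * operand_val x z b)"
    by (intro diff_degree_le_add diff_degree_le_cmult diff_degree_le_operand_val)
  from diff_degree_le_mono[OF this assms(4)] show ?thesis by (simp add: Branch)
next
  case (Output a)
  then show ?thesis
    using diff_degree_le_mono[OF diff_degree_le_operand_val assms(4)] by simp
qed

text \<open>
  Edges lead to later nodes, so the rounding errors of earlier nodes cannot influence what follows.
  So the errors can be chosen one by one.
\<close>

lemma run_cong_later: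
  assumes "run G x \<delta> i env y" "\<forall>i<length G. node_ok Q G i (G ! i)"
    and "\<And>k. i \<le> k \<Longrightarrow> \<delta>' k = \<delta> k"
  shows "run G x \<delta>' i env y"
  using assms(1,3)
proof (induction rule: run.induct)
  case (run_Compute i b args j env vals y)
  have "node_ok Q G i (G ! i)" using assms(2) run_Compute.hyps(1) by blast
  then have "i < j" using run_Compute.hyps(2) by simp
  then have "run G x \<delta>' j (env(i \<mapsto> apply_blackbox b vals * (1 + \<delta> i))) y"
    using run_Compute.IH run_Compute.prems by (simp del: fun_upd_apply)
  then show ?case using run.run_Compute[OF run_Compute.hyps(1-3)] run_Compute.prems[of i] by (simp del: fun_upd_apply)
next
  case (run_Branch i c a b j k env s t y)
  have "node_ok Q G i (G ! i)" using assms(2) run_Branch.hyps(1) by blast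
  then have "i < (if compare c s t then j else k)" using run_Branch.hyps(2) by simp
  then have "run G x \<delta>' (if compare c s t then j else k) env y"
    using run_Branch.IH run_Branch.prems by (meson le_trans less_imp_le)
  then show ?case using run.run_Branch[OF run_Branch.hyps(1-4)] by blast
qed (auto intro: run.run_Output)

lemma eventually_compare_eq:
  fixes f g :: "'a::topological_space \<Rightarrow> real"
  assumes "(f \<longlongrightarrow> f a) (nhds a)" "(g \<longlongrightarrow> g a) (nhds a)" "f a \<noteq> g a"
  shows "\<forall>\<^sub>F t in nhds a. compare c (f t) (g t) = compare c (f a) (g a)"
proof -
  consider "f a < g a" | "g a < f a" using assms(3) by linarith
  then show ?thesis
  proof cases
    case 1
    have "\<forall>\<^sub>F t in nhds a. 0 < g t - f t"
      using order_tendstoD(1)[OF tendsto_diff[OF assms(2,1)], of 0] 1 by simp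
    then show ?thesis by (rule eventually_mono) (use 1 in \<open>cases c; simp\<close>)
  next
    case 2
    have "\<forall>\<^sub>F t in nhds a. 0 < f t - g t"
      using order_tendstoD(1)[OF tendsto_diff[OF assms(1,2)], of 0] 2 by simp
    then show ?thesis by (rule eventually_mono) (use 2 in \<open>cases c; simp\<close>)
  qed
qed

text \<open>
  The node polynomials that are not the zero polynomial, over all sets of nodes that may hold
  nonzero results. The point \<open>x0\<close> is generic if all of them are nonzero in \<open>z\<close> at \<open>x0\<close>.
\<close>

definition nonzero_patterns :: "'v graph \<Rightarrow> (nat \<times> nat set) set" where
  "nonzero_patterns G = {(k, T). k < length G \<and> T \<subseteq> {..<length G} \<and>
     (\<exists>x z. node_val x (zero_outside T z) (G ! k) \<noteq> 0)}"

lemma finite_nonzero_patterns: "finite (nonzero_patterns G)"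
  by (rule finite_subset[of _ "{..<length G} \<times> Pow {..<length G}"])
     (auto simp: nonzero_patterns_def)

lemma zero_outside_cong: "(\<And>s. s \<in> S \<Longrightarrow> z s = z' s) \<Longrightarrow> zero_outside S z = zero_outside S z'"
  by (auto simp: zero_outside_def fun_eq_iff)

lemma range_poly_zero_outside_upd: "(\<lambda>t. zero_outside T (z(i := t)) k) \<in> range poly"
proof (cases "k \<in> T \<and> k = i")
  case True
  then have "(\<lambda>t. zero_outside T (z(i := t)) k) = (\<lambda>t. t)" by (auto simp: zero_outside_def)
  then show ?thesis by (simp add: range_poly_ident)
next
  case False
  then have "(\<lambda>t. zero_outside T (z(i := t)) k) = (\<lambda>t. zero_outside T z k)" by (auto simp: zero_outside_def)
  then show ?thesis by (simp add: range_poly_const)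
qed

text \<open>
  Either some small rounding errors lead to a nonzero output at \<open>\<xi> 0\<close>, or
  small rounding errors lead to the output 0 at all nearby points of the curve \<open>\<xi>\<close>. The
  statement is about an execution from node \<open>i\<close> on; the nodes in \<open>S\<close> have nonzero results that were fixed in \<open>z\<close>, and the
  assumption on \<open>nonzero_patterns\<close> keeps the point generic: each polynomial still has a nonroot
  that extends this choice.
  
  The results are chosen before the errors: for a node with nonzero polynomial value
  \<open>g x\<close>, a result \<open>v\<close> close to \<open>g (\<xi> 0)\<close> is produced at the
  input \<open>x\<close> by the error \<open>v / g x - 1\<close>, which is continuous in \<open>x\<close>. So the same results
  can be obtained at all nearby inputs, and the later polynomials are evaluated at the same \<open>z\<close>.
\<close>

lemma run_at_generic_point:
  fixes G :: "'v graph" and \<xi> :: "real \<Rightarrow> 'v \<Rightarrow> real"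
  assumes ok: "\<forall>i<length G. node_ok Q G i (G ! i)" and bb: "\<forall>b\<in>Q. is_blackbox b"
    and \<xi>: "\<And>v. (\<lambda>t. \<xi> t v) \<in> range poly" and \<epsilon>: "0 < \<epsilon>"
    and "S \<subseteq> {..<i}" "dom env \<subseteq> {..<i}" "env \<subseteq>\<^sub>m Some \<circ> zero_outside S z"
    and "\<And>k T. (k, T) \<in> nonzero_patterns G \<Longrightarrow>
           \<exists>z'. (\<forall>s\<in>S. z' s = z s) \<and> node_val (\<xi> 0) (zero_outside T z') (G ! k) \<noteq> 0"
    and "\<And>\<delta>. \<exists>y. run G (\<xi> 0) \<delta> i env y"
  shows "(\<exists>\<delta> y. (\<forall>k. \<bar>\<delta> k\<bar> \<le> \<epsilon>) \<and> y \<noteq> 0 \<and> run G (\<xi> 0) \<delta> i env y) \<or>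
         (\<forall>\<^sub>F t in nhds 0. \<exists>\<delta>. (\<forall>k. \<bar>\<delta> k\<bar> \<le> \<epsilon>) \<and> run G (\<xi> t) \<delta> i env 0)"
  using assms(5-)
proof (induction "length G - i" arbitrary: i env S z rule: less_induct)
  case less
  note S = less.prems(1) and dom = less.prems(2) and env = less.prems(3)
    and compl = less.prems(4) and total = less.prems(5)
  have "i \<notin> S" using S by auto
  define g where "g x = node_val x (zero_outside S z) (G ! i)" for x
  obtain y where run_i: "run G (\<xi> 0) (\<lambda>_. 0) i env y" using total by blast
  then have i: "i < length G" by (cases rule: run.cases) auto
  have ok_i: "node_ok Q G i (G ! i)" using ok i by blast
  have pat: "(i, S) \<in> nonzero_patterns G \<longleftrightarrow> (\<exists>x z. node_val x (zero_outside S z) (G ! i) \<noteq> 0)"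
    using i S by (auto simp: nonzero_patterns_def)
  have g_zero: "g x = 0" if "(i, S) \<notin> nonzero_patterns G" for x
    using that pat by (auto simp: g_def)
  have g_nonzero: "g (\<xi> 0) \<noteq> 0" if pat_i: "(i, S) \<in> nonzero_patterns G"
  proof -
    from compl[OF pat_i] obtain z' where "\<forall>s\<in>S. z' s = z s"
      and nz: "node_val (\<xi> 0) (zero_outside S z') (G ! i) \<noteq> 0" by blast
    then have "zero_outside S z' = zero_outside S z" by (intro zero_outside_cong) auto
    with nz show ?thesis by (simp add: g_def)
  qed
  have tendsto_node: "((\<lambda>t. g (\<xi> t)) \<longlongrightarrow> g (\<xi> 0)) (nhds 0)"
    unfolding g_def
    by (rule tendsto_range_poly[OF range_poly_node_val[OF ok_i bb \<xi> range_poly_const]])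
  show ?case
  proof (cases "G ! i")
    case (Output a)
    from run_i obtain s where "operand_value (\<xi> 0) env a = Some s"
      by (cases rule: run.cases) (auto simp: Output)
    then have "operand_value x env a = Some (g x)" for x
      using operand_value_eq[OF _ env] by (simp add: g_def Output)
    then have run: "run G x \<delta> i env (g x)" for x \<delta>
      by (intro run_Output[OF i Output])
    show ?thesis
    proof (cases "(i, S) \<in> nonzero_patterns G")
      case True
      from run[of "\<xi> 0" "\<lambda>_. 0"] g_nonzero[OF True] \<epsilon> show ?thesis
        by (intro disjI1 exI[of _ "\<lambda>_. 0"] exI[of _ "g (\<xi> 0)"]) simp
    next
      case False
      have "run G x (\<lambda>_. 0) i env 0" for x
        using run[of x "\<lambda>_. 0"] g_zero[OF False] by simp
      then show ?thesis using \<epsilon> by (intro disjI2 always_eventually allI exI[of _ "\<lambda>_. 0"]) simp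
    qed
  next
    case (Branch c a b j k)
    define va vb where "va x = operand_val x (zero_outside S z) a" and "vb x = operand_val x (zero_outside S z) b" for x
    from run_i obtain s t where "operand_value (\<xi> 0) env a = Some s" "operand_value (\<xi> 0) env b = Some t"
      by (cases rule: run.cases) (auto simp: Branch)
    then have val: "operand_value x env a = Some (va x)" "operand_value x env b = Some (vb x)" for x
      using operand_value_eq[OF _ env] by (auto simp: va_def vb_def)
    define next_node where "next_node x = (if compare c (va x) (vb x) then j else k)" for x
    have step: "run G x \<delta> i env y \<longleftrightarrow> run G x \<delta> (next_node x) env y" for x \<delta> y
    proof
      assume "run G x \<delta> i env y"
      then show "run G x \<delta> (next_node x) env y"
        by (cases rule: run.cases) (auto simp: Branch val next_node_def)
    next
      assume "run G x \<delta> (next_node x) env y"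
      then show "run G x \<delta> i env y"
        unfolding next_node_def by (rule run_Branch[OF i Branch val])
    qed
    have next_eq: "\<forall>\<^sub>F t in nhds 0. next_node (\<xi> t) = next_node (\<xi> 0)"
    proof (cases "(i, S) \<in> nonzero_patterns G")
      case True
      have "((\<lambda>t. va (\<xi> t)) \<longlongrightarrow> va (\<xi> 0)) (nhds 0)" "((\<lambda>t. vb (\<xi> t)) \<longlongrightarrow> vb (\<xi> 0)) (nhds 0)"
        unfolding va_def vb_def
        by (rule tendsto_range_poly[OF range_poly_operand_val[OF \<xi> range_poly_const]])+
      moreover have "va (\<xi> 0) \<noteq> vb (\<xi> 0)"
        using g_nonzero[OF True] by (simp add: g_def Branch va_def vb_def)
      ultimately have "\<forall>\<^sub>F t in nhds 0. compare c (va (\<xi> t)) (vb (\<xi> t)) = compare c (va (\<xi> 0)) (vb (\<xi> 0))"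
        by (rule eventually_compare_eq)
      then show ?thesis by (rule eventually_mono) (simp add: next_node_def)
    next
      case False
      have "va x = vb x" for x
        using g_zero[OF False, of x] by (simp add: g_def Branch va_def vb_def)
      then have "compare c (va x) (vb x) \<longleftrightarrow> c \<noteq> Cmp_Less" for x
        by (cases c) simp_all
      then show ?thesis by (intro always_eventually allI) (simp add: next_node_def)
    qed
    let ?j = "next_node (\<xi> 0)"
    have j: "i < ?j" "?j < length G" using ok_i by (auto simp: Branch next_node_def)
    have "(\<exists>\<delta> y. (\<forall>k. \<bar>\<delta> k\<bar> \<le> \<epsilon>) \<and> y \<noteq> 0 \<and> run G (\<xi> 0) \<delta> ?j env y) \<or>
         (\<forall>\<^sub>F t in nhds 0. \<exists>\<delta>. (\<forall>k. \<bar>\<delta> k\<bar> \<le> \<epsilon>) \<and> run G (\<xi> t) \<delta> ?j env 0)"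
    proof (rule less.hyps)
      show "length G - ?j < length G - i" using j by simp
      show "S \<subseteq> {..<?j}" "dom env \<subseteq> {..<?j}" using S dom j(1) by (auto intro: less_trans)
      show "\<exists>y. run G (\<xi> 0) \<delta> ?j env y" for \<delta> using total step by blast
    qed (use env compl in auto)
    then show ?thesis
    proof
      assume "\<exists>\<delta> y. (\<forall>k. \<bar>\<delta> k\<bar> \<le> \<epsilon>) \<and> y \<noteq> 0 \<and> run G (\<xi> 0) \<delta> ?j env y"
      then show ?thesis using step by blast
    next
      assume "\<forall>\<^sub>F t in nhds 0. \<exists>\<delta>. (\<forall>k. \<bar>\<delta> k\<bar> \<le> \<epsilon>) \<and> run G (\<xi> t) \<delta> ?j env 0"
      with next_eq have "\<forall>\<^sub>F t in nhds 0. \<exists>\<delta>. (\<forall>k. \<bar>\<delta> k\<bar> \<le> \<epsilon>) \<and> run G (\<xi> t) \<delta> i env 0"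
        by (rule eventually_elim2) (simp add: step)
      then show ?thesis ..
    qed
  next
    case (Compute b args j)
    have j: "i < j" "j < length G" using ok_i by (auto simp: Compute)
    from run_i obtain vals where "map (operand_value (\<xi> 0) env) args = map Some vals"
      by (cases rule: run.cases) (auto simp: Compute)
    then have val: "map (operand_value x env) args = map Some (map (operand_val x (zero_outside S z)) args)" for x
      using operand_values_eq[OF _ env] by blast
    have g: "g x = apply_blackbox b (map (operand_val x (zero_outside S z)) args)" for x
      by (simp add: g_def Compute)
    have step: "run G x \<delta> i env y \<longleftrightarrow> run G x \<delta> j (env(i \<mapsto> g x * (1 + \<delta> i))) y" for x \<delta> y
    proof
      assume "run G x \<delta> i env y"
      then show "run G x \<delta> j (env(i \<mapsto> g x * (1 + \<delta> i))) y"
      proof (cases rule: run.cases)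
        case (run_Compute b' args' j' vals)
        then have eq: "b' = b" "args' = args" "j' = j" by (auto simp: Compute)
        with run_Compute(3) val[of x] have "map Some vals = map Some (map (operand_val x (zero_outside S z)) args)"
          by simp
        then have "vals = map (operand_val x (zero_outside S z)) args"
          by (rule map_injective) simp
        with run_Compute(4) eq show ?thesis by (simp only: g)
      qed (auto simp: Compute)
    next
      assume "run G x \<delta> j (env(i \<mapsto> g x * (1 + \<delta> i))) y"
      then show "run G x \<delta> i env y"
        unfolding g by (rule run_Compute[OF i Compute val])
    qed
    have step': "run G x (\<delta>(i := u)) i env y" if "run G x \<delta> j (env(i \<mapsto> r)) y" "r = g x * (1 + u)" for x \<delta> u y r
      unfolding step using run_cong_later[OF that(1) ok, of "\<delta>(i := u)"] j(1) that(2)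
      by (simp del: fun_upd_apply add: fun_upd_same fun_upd_other)
    have total': "\<exists>y. run G (\<xi> 0) \<delta> j (env(i \<mapsto> g (\<xi> 0) * (1 + u))) y" for \<delta> u
    proof -
      obtain y where "run G (\<xi> 0) (\<delta>(i := u)) i env y" using total by blast
      then have "run G (\<xi> 0) (\<delta>(i := u)) j (env(i \<mapsto> g (\<xi> 0) * (1 + u))) y" by (simp add: step)
      from run_cong_later[OF this ok, of \<delta>] j(1) show ?thesis by auto
    qed
    show ?thesis
    proof (cases "(i, S) \<in> nonzero_patterns G")
      case False
      have "(\<exists>\<delta> y. (\<forall>k. \<bar>\<delta> k\<bar> \<le> \<epsilon>) \<and> y \<noteq> 0 \<and> run G (\<xi> 0) \<delta> j (env(i \<mapsto> 0)) y) \<or>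
         (\<forall>\<^sub>F t in nhds 0. \<exists>\<delta>. (\<forall>k. \<bar>\<delta> k\<bar> \<le> \<epsilon>) \<and> run G (\<xi> t) \<delta> j (env(i \<mapsto> 0)) 0)"
      proof (rule less.hyps)
        show "length G - j < length G - i" using j by simp
        show "S \<subseteq> {..<j}" "dom (env(i \<mapsto> 0)) \<subseteq> {..<j}" using S dom j(1) by (auto intro: less_trans)
        show "env(i \<mapsto> 0) \<subseteq>\<^sub>m Some \<circ> zero_outside S z"
          using env \<open>i \<notin> S\<close> by (auto simp: map_le_def zero_outside_def)
        show "\<exists>y. run G (\<xi> 0) \<delta> j (env(i \<mapsto> 0)) y" for \<delta>
          using total'[of \<delta> 0] g_zero[OF False] by simp
      qed (use compl in auto)
      then show ?thesis by (simp add: step g_zero[OF False])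
    next
      case True
      define r0 where "r0 = g (\<xi> 0)"
      have r0: "r0 \<noteq> 0" using g_nonzero[OF True] by (simp add: r0_def)
      obtain Z where Z: "\<And>k T. (k, T) \<in> nonzero_patterns G \<Longrightarrow>
          (\<forall>s\<in>S. Z k T s = z s) \<and> node_val (\<xi> 0) (zero_outside T (Z k T)) (G ! k) \<noteq> 0"
        using compl by metis
      \<comment> \<open>For each polynomial, only finitely many results of node \<open>i\<close> would spoil the nonroot.\<close>
      define bad where "bad = (\<Union>(k, T) \<in> nonzero_patterns G.
          {v. node_val (\<xi> 0) (zero_outside T ((Z k T)(i := v))) (G ! k) = 0})"
      have fin: "finite {v. node_val (\<xi> 0) (zero_outside T ((Z k T)(i := v))) (G ! k) = 0}"
        if kT: "(k, T) \<in> nonzero_patterns G" for k T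
      proof (rule finite_roots_range_poly)
        have "node_ok Q G k (G ! k)" using ok kT by (auto simp: nonzero_patterns_def)
        then show "(\<lambda>v. node_val (\<xi> 0) (zero_outside T ((Z k T)(i := v))) (G ! k)) \<in> range poly"
          by (rule range_poly_node_val[OF _ bb range_poly_const range_poly_zero_outside_upd])
        show "node_val (\<xi> 0) (zero_outside T ((Z k T)(i := Z k T i))) (G ! k) \<noteq> 0"
          using Z[OF kT] by simp
      qed
      have "finite bad"
        unfolding bad_def by (rule finite_UN_I[OF finite_nonzero_patterns]) (use fin in auto)
      then have "finite ((\<lambda>v. v / r0 - 1) ` bad)" by simp
      then have "infinite ({0<..<\<epsilon>} - (\<lambda>v. v / r0 - 1) ` bad)"
        by (rule Diff_infinite_finite[OF _ infinite_Ioo[OF \<epsilon>]])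
      then obtain u where u: "u \<in> {0<..<\<epsilon>}" "u \<notin> (\<lambda>v. v / r0 - 1) ` bad"
        using infinite_imp_nonempty by blast
      define v where "v = r0 * (1 + u)"
      have "v / r0 - 1 = u" using r0 by (simp add: v_def)
      with u(2) have v: "v \<notin> bad" by blast
      have "(\<exists>\<delta> y. (\<forall>k. \<bar>\<delta> k\<bar> \<le> \<epsilon>) \<and> y \<noteq> 0 \<and> run G (\<xi> 0) \<delta> j (env(i \<mapsto> v)) y) \<or>
         (\<forall>\<^sub>F t in nhds 0. \<exists>\<delta>. (\<forall>k. \<bar>\<delta> k\<bar> \<le> \<epsilon>) \<and> run G (\<xi> t) \<delta> j (env(i \<mapsto> v)) 0)"
      proof (rule less.hyps)
        show "length G - j < length G - i" using j by simp
        show "insert i S \<subseteq> {..<j}" "dom (env(i \<mapsto> v)) \<subseteq> {..<j}"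
          using S dom j(1) by (auto intro: less_trans)
        show "env(i \<mapsto> v) \<subseteq>\<^sub>m Some \<circ> zero_outside (insert i S) (z(i := v))"
          using env dom by (auto simp: map_le_def zero_outside_def)
        show "\<exists>y. run G (\<xi> 0) \<delta> j (env(i \<mapsto> v)) y" for \<delta>
          using total'[of \<delta> u] by (simp add: v_def r0_def)
        show "\<exists>z'. (\<forall>s\<in>insert i S. z' s = (z(i := v)) s) \<and> node_val (\<xi> 0) (zero_outside T z') (G ! k) \<noteq> 0"
          if kT: "(k, T) \<in> nonzero_patterns G" for k T
          using Z[OF kT] v kT by (intro exI[of _ "(Z k T)(i := v)"]) (auto simp: bad_def)
      qed
      then show ?thesis
      proof
        assume "\<exists>\<delta> y. (\<forall>k. \<bar>\<delta> k\<bar> \<le> \<epsilon>) \<and> y \<noteq> 0 \<and> run G (\<xi> 0) \<delta> j (env(i \<mapsto> v)) y"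
        then obtain \<delta> y where \<delta>: "\<forall>k. \<bar>\<delta> k\<bar> \<le> \<epsilon>" and "y \<noteq> 0"
          and run: "run G (\<xi> 0) \<delta> j (env(i \<mapsto> v)) y" by blast
        have "run G (\<xi> 0) (\<delta>(i := u)) i env y"
          by (rule step'[OF run]) (simp add: v_def r0_def)
        moreover have "\<forall>k. \<bar>(\<delta>(i := u)) k\<bar> \<le> \<epsilon>" using \<delta> u(1) by auto
        ultimately show ?thesis using \<open>y \<noteq> 0\<close> by blast
      next
        assume ev: "\<forall>\<^sub>F t in nhds 0. \<exists>\<delta>. (\<forall>k. \<bar>\<delta> k\<bar> \<le> \<epsilon>) \<and> run G (\<xi> t) \<delta> j (env(i \<mapsto> v)) 0"
        have lim: "((\<lambda>t. \<bar>v / g (\<xi> t) - 1\<bar>) \<longlongrightarrow> \<bar>v / r0 - 1\<bar>) (nhds 0)"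
          using tendsto_node r0 unfolding r0_def by (intro tendsto_intros)
        have "\<bar>v / r0 - 1\<bar> < \<epsilon>" using u(1) \<open>v / r0 - 1 = u\<close> by simp
        from order_tendstoD(2)[OF lim this]
        have small: "\<forall>\<^sub>F t in nhds 0. \<bar>v / g (\<xi> t) - 1\<bar> < \<epsilon>" .
        have "\<forall>\<^sub>F t in nhds 0. g (\<xi> t) \<noteq> 0"
          using tendsto_imp_eventually_ne[OF tendsto_node] r0 by (simp add: r0_def)
        with ev small have "\<forall>\<^sub>F t in nhds 0. \<exists>\<delta>. (\<forall>k. \<bar>\<delta> k\<bar> \<le> \<epsilon>) \<and> run G (\<xi> t) \<delta> i env 0"
        proof eventually_elim
          case (elim t)
          then obtain \<delta> where \<delta>: "\<forall>k. \<bar>\<delta> k\<bar> \<le> \<epsilon>"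
            and run: "run G (\<xi> t) \<delta> j (env(i \<mapsto> v)) 0" by blast
          define u' where "u' = v / g (\<xi> t) - 1"
          have "run G (\<xi> t) (\<delta>(i := u')) i env 0"
            by (rule step'[OF run]) (use elim in \<open>simp add: u'_def\<close>)
          moreover have "\<forall>k. \<bar>(\<delta>(i := u')) k\<bar> \<le> \<epsilon>" using \<delta> elim by (auto simp: u'_def)
          ultimately show ?case by blast
        qed
        then show ?thesis ..
      qed
    qed
  qed
qed

section \<open>Inaccuracy for Toeplitz determinants\<close>

lemma not_accurately_evaluable_det_toeplitz:
  assumes bb: "\<forall>b\<in>Q. is_blackbox b" and deg: "\<forall>b\<in>Q. total_degree (snd b) \<le> d"
    and "1 \<le> d" "d < n"
  shows "\<not> accurately_evaluable Q {1 - int n..int n - 1} ({1 - int n..int n - 1} \<rightarrow>\<^sub>E UNIV)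
           (\<lambda>x. Determinant.det (toeplitz_mat n x))"
proof
  define V where "V = {1 - int n..int n - 1}"
  define p where "p x = Determinant.det (toeplitz_mat n x)" for x
  assume "accurately_evaluable Q {1 - int n..int n - 1} ({1 - int n..int n - 1} \<rightarrow>\<^sub>E UNIV)
           (\<lambda>x. Determinant.det (toeplitz_mat n x))"
  then obtain G where alg: "algorithm Q V G" and acc: "accurate_on (V \<rightarrow>\<^sub>E UNIV) p G"
    by (auto simp: accurately_evaluable_def algorithm_for_def V_def p_def[abs_def])
  have ok: "\<forall>i<length G. node_ok Q G i (G ! i)" using alg by (simp add: algorithm_def)
  \<comment> \<open>As \<open>\<eta> < 1\<close>, under small errors the computed value is 0 exactly where the determinant is 0.\<close>
  have "0 < (1/2::real) \<and> (1/2::real) < 1" by simp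
  with acc obtain \<epsilon> where \<epsilon>: "0 < \<epsilon>"
    and acc: "\<And>x \<delta>. x \<in> V \<rightarrow>\<^sub>E UNIV \<Longrightarrow> \<forall>i. \<bar>\<delta> i\<bar> \<le> \<epsilon> \<Longrightarrow> \<bar>p_comp G x \<delta> - p x\<bar> \<le> 1/2 * \<bar>p x\<bar>"
    unfolding accurate_on_def by blast
  have p_comp: "p_comp G x \<delta> = y" if "x \<in> V \<rightarrow>\<^sub>E UNIV" "run G x \<delta> 0 Map.empty y" for x \<delta> y
    using alg that unfolding algorithm_def p_comp_def by (metis the1_equality)
  \<comment> \<open>The exponents are shifted to be nonnegative; for a nonzero ratio this only rescales the progression.\<close>
  define e where "e k = nat (k + int n - 1)" for k
  have inj: "inj_on e V" by (auto simp: inj_on_def e_def V_def)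
  have inputs: "node_inputs (G ! k) \<subseteq> V" if "k < length G" for k
    using alg that by (simp add: algorithm_def)
  have "\<exists>z w. node_val (geometric_sum e d w) (zero_outside T z) (G ! k) \<noteq> 0"
    if kT: "(k, T) \<in> nonzero_patterns G" for k T
  proof (rule ccontr)
    assume zero: "\<not> ?thesis"
    from kT obtain x z where k: "k < length G" and nz: "node_val x (zero_outside T z) (G ! k) \<noteq> 0"
      by (auto simp: nonzero_patterns_def)
    have "node_val x (zero_outside T z) (G ! k) = 0"
    proof (rule diff_degree_le_zero_on_geometric_sums[where V = V and e = e and d = d
          and f = "\<lambda>x. node_val x (zero_outside T z) (G ! k)" and x = x])
      show "diff_degree_le d (\<lambda>x. node_val x (zero_outside T z) (G ! k))"
        using ok k by (intro diff_degree_le_node_val[OF _ bb deg \<open>1 \<le> d\<close>]) blast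
      show "node_val x (zero_outside T z) (G ! k) = node_val y (zero_outside T z) (G ! k)"
        if "\<And>v. v \<in> V \<Longrightarrow> x v = y v" for x y
        using that inputs[OF k] by (intro node_val_cong) auto
    qed (use zero inj in \<open>auto simp: V_def\<close>)
    with nz show False ..
  qed
  then obtain Z where Z: "\<And>k T. (k, T) \<in> nonzero_patterns G \<Longrightarrow>
      \<exists>w. node_val (geometric_sum e d w) (zero_outside T (Z k T)) (G ! k) \<noteq> 0"
    by metis
  define h where "h = (\<lambda>(k, T) w. node_val (geometric_sum e d w) (zero_outside T (Z k T)) (G ! k))"
  have "\<exists>w. \<forall>f \<in> h ` nonzero_patterns G. f w \<noteq> 0"
  proof (rule common_nonroot)
    show "finite (h ` nonzero_patterns G)" using finite_nonzero_patterns by blast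
  next
    fix f a b assume "f \<in> h ` nonzero_patterns G"
    then obtain k T where f: "f = h (k, T)" and "(k, T) \<in> nonzero_patterns G" by auto
    then have "node_ok Q G k (G ! k)" using ok by (auto simp: nonzero_patterns_def)
    moreover have "(\<lambda>t. geometric_sum e d (\<lambda>i. a i + t * (b i - a i)) v) \<in> range poly" for v
      unfolding geometric_sum_def
      by (intro range_poly_sum range_poly_mult range_poly_power range_poly_add range_poly_const range_poly_ident)
    ultimately show "(\<lambda>t. f (\<lambda>i. a i + t * (b i - a i))) \<in> range poly"
      unfolding f h_def prod.case by (rule range_poly_node_val[OF _ bb _ range_poly_const])
  next
    fix f assume "f \<in> h ` nonzero_patterns G"
    then show "\<exists>w. f w \<noteq> 0" using Z by (auto simp: h_def)
  qed
  then obtain w where h_w: "\<forall>f \<in> h ` nonzero_patterns G. f w \<noteq> 0" by blast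
  have w: "node_val (geometric_sum e d w) (zero_outside T (Z k T)) (G ! k) \<noteq> 0"
    if "(k, T) \<in> nonzero_patterns G" for k T
    using h_w that by (force simp: h_def)
  define x0 where "x0 = restrict (geometric_sum e d w) V"
  \<comment> \<open>The line through \<open>x0\<close> in the direction of the identity matrix.\<close>
  define \<xi> where "\<xi> t = x0(0 := x0 0 + t)" for t
  have "0 \<in> V" using \<open>d < n\<close> by (simp add: V_def)
  then have \<xi>_V: "\<xi> t \<in> V \<rightarrow>\<^sub>E UNIV" for t
    by (auto simp: \<xi>_def x0_def PiE_def extensional_def)
  have \<xi>0: "\<xi> 0 = x0" by (simp add: \<xi>_def)
  have px0: "p x0 = 0"
    unfolding p_def by (rule det_toeplitz_geometric_sum[OF \<open>d < n\<close>, of e _ w])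
      (auto simp: e_def x0_def V_def)
  have "(\<exists>\<delta> y. (\<forall>k. \<bar>\<delta> k\<bar> \<le> \<epsilon>) \<and> y \<noteq> 0 \<and> run G (\<xi> 0) \<delta> 0 Map.empty y) \<or>
         (\<forall>\<^sub>F t in nhds 0. \<exists>\<delta>. (\<forall>k. \<bar>\<delta> k\<bar> \<le> \<epsilon>) \<and> run G (\<xi> t) \<delta> 0 Map.empty 0)"
  proof (rule run_at_generic_point[OF ok bb _ \<epsilon>, where S = "{}" and z = "\<lambda>_. 0"])
    show "(\<lambda>t. \<xi> t v) \<in> range poly" for v
      by (cases "v = 0") (simp_all add: \<xi>_def range_poly_add range_poly_const range_poly_ident)
    show "\<exists>y. run G (\<xi> 0) \<delta> 0 Map.empty y" for \<delta>
      using alg \<xi>_V unfolding algorithm_def by blast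
    show "\<exists>z'. (\<forall>s\<in>{}. z' s = 0) \<and> node_val (\<xi> 0) (zero_outside T z') (G ! k) \<noteq> 0"
      if kT: "(k, T) \<in> nonzero_patterns G" for k T
    proof -
      have "k < length G" using kT by (auto simp: nonzero_patterns_def)
      then have "node_val x0 (zero_outside T (Z k T)) (G ! k) = node_val (geometric_sum e d w) (zero_outside T (Z k T)) (G ! k)"
        using inputs by (intro node_val_cong) (auto simp: x0_def)
      then show ?thesis using w[OF kT] \<xi>0 by (intro exI[of _ "Z k T"]) simp
    qed
  qed auto
  then show False
  proof
    assume "\<exists>\<delta> y. (\<forall>k. \<bar>\<delta> k\<bar> \<le> \<epsilon>) \<and> y \<noteq> 0 \<and> run G (\<xi> 0) \<delta> 0 Map.empty y"
    then obtain \<delta> y where \<delta>: "\<forall>k. \<bar>\<delta> k\<bar> \<le> \<epsilon>" and "y \<noteq> 0"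
      and "run G (\<xi> 0) \<delta> 0 Map.empty y" by blast
    then have "p_comp G (\<xi> 0) \<delta> = y" using p_comp[OF \<xi>_V[of 0]] by blast
    with acc[OF \<xi>_V[of 0] \<delta>] px0 \<open>y \<noteq> 0\<close> show False by (simp add: \<xi>0)
  next
    assume "\<forall>\<^sub>F t in nhds 0. \<exists>\<delta>. (\<forall>k. \<bar>\<delta> k\<bar> \<le> \<epsilon>) \<and> run G (\<xi> t) \<delta> 0 Map.empty 0"
    then have "\<forall>\<^sub>F t in nhds 0. p (\<xi> t) = 0"
    proof eventually_elim
      case (elim t)
      then obtain \<delta> where "\<forall>k. \<bar>\<delta> k\<bar> \<le> \<epsilon>" "p_comp G (\<xi> t) \<delta> = 0" using p_comp[OF \<xi>_V] by blast
      with acc[OF \<xi>_V[of t], of \<delta>] have "\<bar>0 - p (\<xi> t)\<bar> \<le> 1/2 * \<bar>p (\<xi> t)\<bar>" by simp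
      then show "p (\<xi> t) = 0" by simp
    qed
    then obtain r where "0 < r" and r: "\<And>t. dist t 0 < r \<Longrightarrow> p (\<xi> t) = 0"
      by (auto simp: eventually_nhds_metric)
    then have "{0<..<r} \<subseteq> {t. p (\<xi> t) = 0}" by auto
    moreover have "finite {t. p (\<xi> t) = 0}"
      unfolding p_def \<xi>_def by (rule finite_det_toeplitz_diagonal_shift)
    ultimately show False
      using infinite_Ioo[OF \<open>0 < r\<close>] finite_subset by blast
  qed
qed

theorem corollary3p45:
  fixes Q :: "blackbox set"
  assumes "blackbox_set Q"
    and "countable Q"
    and "bounded_degree Q"
  shows "\<not> (\<forall>n \<ge> 1. accurately_evaluable Q {1 - int n..int n - 1}
                 ({1 - int n..int n - 1} \<rightarrow>\<^sub>E UNIV)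
                 (\<lambda>x. Determinant.det (toeplitz_mat n x)))"
proof -
  obtain d where d: "\<forall>b \<in> Q. total_degree (snd b) \<le> d"
    using assms(3) by (auto simp: bounded_degree_def)
  have "\<forall>b \<in> Q. is_blackbox b" using assms(1) by (simp add: blackbox_set_def)
  \<comment> \<open>\<open>Suc d\<close> instead of \<open>d\<close>, as inputs, comparisons and outputs have degree 1.\<close>
  moreover have "\<forall>b \<in> Q. total_degree (snd b) \<le> Suc d" using d by auto
  ultimately show ?thesis
    using not_accurately_evaluable_det_toeplitz[of Q "Suc d" "Suc (Suc d)"]
    by (intro notI) (auto dest: spec[of _ "Suc (Suc d)"])
qed

end
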